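(* Suppose that there is a model structure on the category $\mathbf{PrSh}(\square)$ of precubical sets, together with a realization functor $L:\mathbf{PrSh}(\square)\to\mathbf{Flow}$, such that the adjunction $(L\dashv N_L):\mathbf{PrSh}(\square)\rightleftarrows\mathbf{Flow}$ is a Quillen pair, where $\mathbf{Flow}$ carries the model structure described in the context. Then $(L\dashv N_L)$ is not a Quillen equivalence.
   Context: $\mathbf{Top}$ is a fixed convenient category of topological spaces (e.g. $\Delta$-generated or compactly generated weak Hausdorff spaces): a full replete subcategory of all topological spaces that is cartesian closed, bicomplete and contains all CW complexes. "Space" means an object of $\mathbf{Top}$. A flow $X=(X^0,\mathbb{P}X,s,t,* )$ consists of a discrete set $X^0$ (states), a space $\mathbb{P}X$ (the path space), continuous maps $s,t:\mathbb{P}X\to X^0$, and a continuous associative concatenation $*:\{(x,y)\in\mathbb{P}X\times\mathbb{P}X : t(x)=s(y)\}\to\mathbb{P}X$ with $s(x*y)=s(x)$, $t(x*y)=t(y)$. (Equivalently, a small $\mathbf{Top}$-enriched semicategory, i.e. category without identities.) A morphism of flows is a set map $f^0:X^0\to Y^0$ and a continuous map $\mathbb{P}f:\mathbb{P}X\to\mathbb{P}Y$ compatible with $s,t,*$. These form the category $\mathbf{Flow}$. For a space $Z$, $\mathrm{Glob}(Z)$ is the flow with states $\{0,1\}$, path space $Z$, $s=0$, $t=1$. $*$ also denotes the flow with one state and empty path space. A weak S-homotopy equivalence is a morphism $f$ with $f^0$ bijective and $\mathbb{P}f$ a weak homotopy equivalence. The model structure on $\mathbf{Flow}$ (taken as known)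 is the combinatorial one whose weak equivalences are the weak S-homotopy equivalences and whose cofibrations are generated by $\{\mathrm{Glob}(S^{n-1})\hookrightarrow\mathrm{Glob}(D^n)\}_{n\ge0}\cup\{\emptyset\hookrightarrow *,\ *\sqcup *\to *\}$, with $S^{-1}=\emptyset$; all flows are fibrant. $\square$ is the category of cubes: objects the posets $\{0<1\}^n$, $n\ge0$, and morphisms the compositions of face maps (inserting a constant coordinate $0$ or $1$). A precubical set is a presheaf of sets on $\square$. $\square[n]$ is the representable presheaf on $\{0<1\}^n$, and $\partial\square[n]\subset\square[n]$ is the subpresheaf of all $k$-cubes with $k<n$ (so $\partial\square[0]=\emptyset$). A poset is viewed as a flow by taking its elements as states, with exactly one path from $x$ to $y$ if $x<y$ and none otherwise; this gives a cocubical flow (functor $\square\to\mathbf{Flow}$) $\{0<1\}^*$. A realization functor is a functor $L=\widehat{X}:\mathbf{PrSh}(\square)\to\mathbf{Flow}$, $\widehat{X}(K)=\varinjlim_{\square[n]\to K}X(\square[n])$ (colimit over the category of cubes of $K$), obtained from a cocubical flow $X:\square\to\mathbf{Flow}$ equipped with an objectwise weak S-homotopy equivalence of cocubical flows $X\to\{0<1\}^*$, such that $\widehat{X}(\partial\square[n])\to\widehat{X}(\square[n])$ is a cofibration of flows for all $n\ge0$. Its right adjoint $N_L$ is given by $N_L(Y)_n=\mathrm{Hom}_{\mathbf{Flow}}(L(\square[n]),Y)$. *)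

theory Defs
  imports "HOL-Analysis.Analysis"
begin

section \<open>Size\<close>

text \<open>
  A type \<open>'u\<close> plays the role of a Grothendieck universe: a set is small if its cardinality
  is strictly smaller than that of \<open>'u\<close>, and \<open>'u\<close> is required to have (strongly) inaccessible
  cardinality. ``Set'', ``space'', ``flow'', ``small (co)limit'' always refer to this universe.
\<close>

definition small :: "'u itself \<Rightarrow> 'a set \<Rightarrow> bool" where
  "small U A \<longleftrightarrow> A \<prec> (UNIV :: 'u set)"

definition universe :: "'u itself \<Rightarrow> bool" where
  "universe U \<longleftrightarrow>
     small U (UNIV :: nat set) \<and>
     (\<forall>A :: 'u set. small U A \<longrightarrow> small U (Pow A)) \<and>
     (\<forall>(I :: 'u set) (A :: 'u \<Rightarrow> 'u set).
        small U I \<and> (\<forall>i\<in>I. small U (A i)) \<longrightarrow> small U (\<Union>i\<in>I. A i))"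

text \<open>
  Standard objects (cubes, spheres, sets of morphisms) live in types other than \<open>'u\<close>; they are
  transported to \<open>'u\<close> along a chosen injection, which exists since they are small.
\<close>

definition code_on :: "'a set \<Rightarrow> 'a \<Rightarrow> 'u" where
  "code_on A = (SOME f. inj_on f A)"

definition code :: "'a \<Rightarrow> 'u" where
  "code = code_on UNIV"

definition decode :: "'u \<Rightarrow> 'a" where
  "decode = inv code"

definition code_top :: "'a topology \<Rightarrow> 'u topology" where
  "code_top X = pullback_topology (code ` topspace X) decode X"


section \<open>Categories\<close>

datatype ('o, 'f) arrow = Arrow (Dom: 'o) (Fn: 'f) (Cod: 'o)

record ('o, 'f) cat =
  Ob :: "'o set"
  Arr :: "('o, 'f) arrow set"
  Ident :: "'o \<Rightarrow> ('o, 'f) arrow"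
  Comp :: "('o, 'f) arrow \<Rightarrow> ('o, 'f) arrow \<Rightarrow> ('o, 'f) arrow"  (infixl \<open>\<odot>\<index>\<close> 70)

definition hom :: "('o, 'f) cat \<Rightarrow> 'o \<Rightarrow> 'o \<Rightarrow> ('o, 'f) arrow set" where
  "hom C A B = {f \<in> Arr C. Dom f = A \<and> Cod f = B}"

definition category :: "('o, 'f) cat \<Rightarrow> bool" where
  "category C \<longleftrightarrow>
     (\<forall>f\<in>Arr C. Dom f \<in> Ob C \<and> Cod f \<in> Ob C) \<and>
     (\<forall>A\<in>Ob C. Ident C A \<in> hom C A A) \<and>
     (\<forall>f\<in>Arr C. \<forall>g\<in>Arr C. Dom g = Cod f \<longrightarrow> g \<odot>\<^bsub>C\<^esub> f \<in> hom C (Dom f) (Cod g)) \<and>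
     (\<forall>f\<in>Arr C. f \<odot>\<^bsub>C\<^esub> Ident C (Dom f) = f \<and> Ident C (Cod f) \<odot>\<^bsub>C\<^esub> f = f) \<and>
     (\<forall>f\<in>Arr C. \<forall>g\<in>Arr C. \<forall>h\<in>Arr C. Dom g = Cod f \<and> Dom h = Cod g \<longrightarrow>
        (h \<odot>\<^bsub>C\<^esub> g) \<odot>\<^bsub>C\<^esub> f = h \<odot>\<^bsub>C\<^esub> (g \<odot>\<^bsub>C\<^esub> f))"

definition op_arrow :: "('o, 'f) arrow \<Rightarrow> ('o, 'f) arrow" where
  "op_arrow f = Arrow (Cod f) (Fn f) (Dom f)"

definition op_cat :: "('o, 'f) cat \<Rightarrow> ('o, 'f) cat" where
  "op_cat C = \<lparr>Ob = Ob C, Arr = op_arrow ` Arr C, Ident = (\<lambda>A. op_arrow (Ident C A)),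
               Comp = (\<lambda>g f. op_arrow (op_arrow f \<odot>\<^bsub>C\<^esub> op_arrow g))\<rparr>"

record ('o, 'f, 'p, 'g) funct =
  fob :: "'o \<Rightarrow> 'p"
  far :: "('o, 'f) arrow \<Rightarrow> ('p, 'g) arrow"

definition is_functor :: "('o, 'f) cat \<Rightarrow> ('p, 'g) cat \<Rightarrow> ('o, 'f, 'p, 'g) funct \<Rightarrow> bool" where
  "is_functor C D F \<longleftrightarrow>
     (\<forall>A\<in>Ob C. fob F A \<in> Ob D) \<and>
     (\<forall>f\<in>Arr C. far F f \<in> hom D (fob F (Dom f)) (fob F (Cod f))) \<and>
     (\<forall>A\<in>Ob C. far F (Ident C A) = Ident D (fob F A)) \<and>
     (\<forall>f\<in>Arr C. \<forall>g\<in>Arr C. Dom g = Cod f \<longrightarrow> far F (g \<odot>\<^bsub>C\<^esub> f) = far F g \<odot>\<^bsub>D\<^esub> far F f)"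

definition nat_trans :: "('o, 'f) cat \<Rightarrow> ('p, 'g) cat \<Rightarrow> ('o, 'f, 'p, 'g) funct \<Rightarrow>
    ('o, 'f, 'p, 'g) funct \<Rightarrow> ('o \<Rightarrow> ('p, 'g) arrow) \<Rightarrow> bool" where
  "nat_trans C D F G \<eta> \<longleftrightarrow>
     (\<forall>A\<in>Ob C. \<eta> A \<in> hom D (fob F A) (fob G A)) \<and>
     (\<forall>f\<in>Arr C. \<eta> (Cod f) \<odot>\<^bsub>D\<^esub> far F f = far G f \<odot>\<^bsub>D\<^esub> \<eta> (Dom f))"

definition functor_cat :: "('o, 'f) cat \<Rightarrow> ('p, 'g) cat \<Rightarrow>
    (('o, 'f, 'p, 'g) funct, 'o \<Rightarrow> ('p, 'g) arrow) cat" where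
  "functor_cat C D =
     \<lparr>Ob = {F. is_functor C D F},
      Arr = {Arrow F \<eta> G | F \<eta> G.
               is_functor C D F \<and> is_functor C D G \<and> nat_trans C D F G \<eta> \<and> \<eta> \<in> extensional (Ob C)},
      Ident = (\<lambda>F. Arrow F (\<lambda>A\<in>Ob C. Ident D (fob F A)) F),
      Comp = (\<lambda>\<beta> \<alpha>. Arrow (Dom \<alpha>) (\<lambda>A\<in>Ob C. Fn \<beta> A \<odot>\<^bsub>D\<^esub> Fn \<alpha> A) (Cod \<beta>))\<rparr>"

definition initial :: "('o, 'f) cat \<Rightarrow> 'o \<Rightarrow> bool" where
  "initial C I \<longleftrightarrow> I \<in> Ob C \<and> (\<forall>A\<in>Ob C. \<exists>!f. f \<in> hom C I A)"

definition terminal :: "('o, 'f) cat \<Rightarrow> 'o \<Rightarrow> bool" where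
  "terminal C E \<longleftrightarrow> E \<in> Ob C \<and> (\<forall>A\<in>Ob C. \<exists>!f. f \<in> hom C A E)"

definition is_cone :: "('j, 'k) cat \<Rightarrow> ('o, 'f) cat \<Rightarrow> ('j, 'k, 'o, 'f) funct \<Rightarrow>
    'o \<Rightarrow> ('j \<Rightarrow> ('o, 'f) arrow) \<Rightarrow> bool" where
  "is_cone J C D A c \<longleftrightarrow> A \<in> Ob C \<and> (\<forall>j\<in>Ob J. c j \<in> hom C A (fob D j)) \<and>
     (\<forall>a\<in>Arr J. far D a \<odot>\<^bsub>C\<^esub> c (Dom a) = c (Cod a))"

definition is_limit :: "('j, 'k) cat \<Rightarrow> ('o, 'f) cat \<Rightarrow> ('j, 'k, 'o, 'f) funct \<Rightarrow>
    'o \<Rightarrow> ('j \<Rightarrow> ('o, 'f) arrow) \<Rightarrow> bool" where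
  "is_limit J C D A c \<longleftrightarrow> is_cone J C D A c \<and>
     (\<forall>B d. is_cone J C D B d \<longrightarrow> (\<exists>!h. h \<in> hom C B A \<and> (\<forall>j\<in>Ob J. c j \<odot>\<^bsub>C\<^esub> h = d j)))"

definition is_cocone :: "('j, 'k) cat \<Rightarrow> ('o, 'f) cat \<Rightarrow> ('j, 'k, 'o, 'f) funct \<Rightarrow>
    'o \<Rightarrow> ('j \<Rightarrow> ('o, 'f) arrow) \<Rightarrow> bool" where
  "is_cocone J C D A c \<longleftrightarrow> A \<in> Ob C \<and> (\<forall>j\<in>Ob J. c j \<in> hom C (fob D j) A) \<and>
     (\<forall>a\<in>Arr J. c (Cod a) \<odot>\<^bsub>C\<^esub> far D a = c (Dom a))"

definition is_colimit :: "('j, 'k) cat \<Rightarrow> ('o, 'f) cat \<Rightarrow> ('j, 'k, 'o, 'f) funct \<Rightarrow>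
    'o \<Rightarrow> ('j \<Rightarrow> ('o, 'f) arrow) \<Rightarrow> bool" where
  "is_colimit J C D A c \<longleftrightarrow> is_cocone J C D A c \<and>
     (\<forall>B d. is_cocone J C D B d \<longrightarrow> (\<exists>!h. h \<in> hom C A B \<and> (\<forall>j\<in>Ob J. h \<odot>\<^bsub>C\<^esub> c j = d j)))"

text \<open>Every small category is isomorphic to one whose objects and morphisms are coded in \<open>'u\<close>.\<close>

definition bicomplete :: "'u itself \<Rightarrow> ('o, 'f) cat \<Rightarrow> bool" where
  "bicomplete U C \<longleftrightarrow>
     (\<forall>(J :: ('u, 'u) cat) D. category J \<and> small U (Ob J) \<and> small U (Arr J) \<and> is_functor J C D \<longrightarrow>
        (\<exists>A c. is_limit J C D A c) \<and> (\<exists>A c. is_colimit J C D A c))"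

definition is_product :: "('o, 'f) cat \<Rightarrow> 'o \<Rightarrow> 'o \<Rightarrow> 'o \<Rightarrow> ('o, 'f) arrow \<Rightarrow> ('o, 'f) arrow \<Rightarrow> bool" where
  "is_product C A B P p q \<longleftrightarrow> p \<in> hom C P A \<and> q \<in> hom C P B \<and>
     (\<forall>Z\<in>Ob C. \<forall>u\<in>hom C Z A. \<forall>v\<in>hom C Z B.
        \<exists>!h. h \<in> hom C Z P \<and> p \<odot>\<^bsub>C\<^esub> h = u \<and> q \<odot>\<^bsub>C\<^esub> h = v)"

definition is_pullback :: "('o, 'f) cat \<Rightarrow> ('o, 'f) arrow \<Rightarrow> ('o, 'f) arrow \<Rightarrow>
    ('o, 'f) arrow \<Rightarrow> ('o, 'f) arrow \<Rightarrow> bool" where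
  "is_pullback C f g p q \<longleftrightarrow>
     p \<in> hom C (Dom p) (Dom f) \<and> q \<in> hom C (Dom p) (Dom g) \<and> f \<odot>\<^bsub>C\<^esub> p = g \<odot>\<^bsub>C\<^esub> q \<and>
     (\<forall>Z\<in>Ob C. \<forall>u\<in>hom C Z (Dom f). \<forall>v\<in>hom C Z (Dom g). f \<odot>\<^bsub>C\<^esub> u = g \<odot>\<^bsub>C\<^esub> v \<longrightarrow>
        (\<exists>!h. h \<in> hom C Z (Dom p) \<and> p \<odot>\<^bsub>C\<^esub> h = u \<and> q \<odot>\<^bsub>C\<^esub> h = v))"

definition cartesian_closed :: "('o, 'f) cat \<Rightarrow> bool" where
  "cartesian_closed C \<longleftrightarrow>
     (\<exists>E. terminal C E) \<and>
     (\<forall>A\<in>Ob C. \<forall>B\<in>Ob C. \<exists>P p q. is_product C A B P p q) \<and>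
     (\<forall>B\<in>Ob C. \<forall>Y\<in>Ob C. \<exists>E\<in>Ob C. \<exists>P p q. \<exists>ev\<in>hom C P Y. is_product C E B P p q \<and>
        (\<forall>A\<in>Ob C. \<forall>Q p' q'. is_product C A B Q p' q' \<longrightarrow>
           (\<forall>g\<in>hom C Q Y. \<exists>!h. h \<in> hom C A E \<and>
              (\<exists>k\<in>hom C Q P. p \<odot>\<^bsub>C\<^esub> k = h \<odot>\<^bsub>C\<^esub> p' \<and> q \<odot>\<^bsub>C\<^esub> k = q' \<and> ev \<odot>\<^bsub>C\<^esub> k = g))))"

text \<open>The map \<open>\<Phi> A B\<close> is the bijection from \<open>hom (F A) B\<close> to \<open>hom A (G B)\<close>.\<close>

definition adjunction :: "('o, 'f) cat \<Rightarrow> ('p, 'g) cat \<Rightarrow> ('o, 'f, 'p, 'g) funct \<Rightarrow>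
    ('p, 'g, 'o, 'f) funct \<Rightarrow> ('o \<Rightarrow> 'p \<Rightarrow> ('p, 'g) arrow \<Rightarrow> ('o, 'f) arrow) \<Rightarrow> bool" where
  "adjunction C D F G \<Phi> \<longleftrightarrow>
     is_functor C D F \<and> is_functor D C G \<and>
     (\<forall>A\<in>Ob C. \<forall>B\<in>Ob D. bij_betw (\<Phi> A B) (hom D (fob F A) B) (hom C A (fob G B))) \<and>
     (\<forall>A\<in>Ob C. \<forall>A'\<in>Ob C. \<forall>B\<in>Ob D. \<forall>f\<in>hom D (fob F A) B. \<forall>a\<in>hom C A' A.
        \<Phi> A' B (f \<odot>\<^bsub>D\<^esub> far F a) = \<Phi> A B f \<odot>\<^bsub>C\<^esub> a) \<and>
     (\<forall>A\<in>Ob C. \<forall>B\<in>Ob D. \<forall>B'\<in>Ob D. \<forall>f\<in>hom D (fob F A) B. \<forall>b\<in>hom D B B'.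
        \<Phi> A B' (b \<odot>\<^bsub>D\<^esub> f) = far G b \<odot>\<^bsub>C\<^esub> \<Phi> A B f)"


section \<open>Model structures\<close>

definition lifts :: "('o, 'f) cat \<Rightarrow> ('o, 'f) arrow \<Rightarrow> ('o, 'f) arrow \<Rightarrow> bool" where
  "lifts C i p \<longleftrightarrow>
     (\<forall>u\<in>hom C (Dom i) (Dom p). \<forall>v\<in>hom C (Cod i) (Cod p). p \<odot>\<^bsub>C\<^esub> u = v \<odot>\<^bsub>C\<^esub> i \<longrightarrow>
        (\<exists>h\<in>hom C (Cod i) (Dom p). h \<odot>\<^bsub>C\<^esub> i = u \<and> p \<odot>\<^bsub>C\<^esub> h = v))"

definition llp :: "('o, 'f) cat \<Rightarrow> ('o, 'f) arrow set \<Rightarrow> ('o, 'f) arrow set" where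
  "llp C S = {i \<in> Arr C. \<forall>p\<in>S. lifts C i p}"

definition rlp :: "('o, 'f) cat \<Rightarrow> ('o, 'f) arrow set \<Rightarrow> ('o, 'f) arrow set" where
  "rlp C S = {p \<in> Arr C. \<forall>i\<in>S. lifts C i p}"

definition retract_of_arrow :: "('o, 'f) cat \<Rightarrow> ('o, 'f) arrow \<Rightarrow> ('o, 'f) arrow \<Rightarrow> bool" where
  "retract_of_arrow C f g \<longleftrightarrow>
     (\<exists>i\<in>hom C (Dom f) (Dom g). \<exists>r\<in>hom C (Dom g) (Dom f).
      \<exists>i'\<in>hom C (Cod f) (Cod g). \<exists>r'\<in>hom C (Cod g) (Cod f).
        r \<odot>\<^bsub>C\<^esub> i = Ident C (Dom f) \<and> r' \<odot>\<^bsub>C\<^esub> i' = Ident C (Cod f) \<and>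
        g \<odot>\<^bsub>C\<^esub> i = i' \<odot>\<^bsub>C\<^esub> f \<and> f \<odot>\<^bsub>C\<^esub> r = r' \<odot>\<^bsub>C\<^esub> g)"

record ('o, 'f) model =
  Weq :: "('o, 'f) arrow set"
  Cof :: "('o, 'f) arrow set"
  Fib :: "('o, 'f) arrow set"

text \<open>
  Bicompleteness of the underlying category is not repeated here. Factorizations are not
  required to be functorial.
\<close>

definition model_structure :: "('o, 'f) cat \<Rightarrow> ('o, 'f) model \<Rightarrow> bool" where
  "model_structure C M \<longleftrightarrow>
     Weq M \<subseteq> Arr C \<and> Cof M \<subseteq> Arr C \<and> Fib M \<subseteq> Arr C \<and>
     (\<forall>f\<in>Arr C. \<forall>g\<in>Arr C. Dom g = Cod f \<longrightarrow>
        (f \<in> Weq M \<and> g \<in> Weq M \<longrightarrow> g \<odot>\<^bsub>C\<^esub> f \<in> Weq M) \<and>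
        (f \<in> Weq M \<and> g \<odot>\<^bsub>C\<^esub> f \<in> Weq M \<longrightarrow> g \<in> Weq M) \<and>
        (g \<in> Weq M \<and> g \<odot>\<^bsub>C\<^esub> f \<in> Weq M \<longrightarrow> f \<in> Weq M)) \<and>
     (\<forall>f\<in>Arr C. \<forall>g\<in>Arr C. retract_of_arrow C f g \<longrightarrow>
        (g \<in> Weq M \<longrightarrow> f \<in> Weq M) \<and> (g \<in> Cof M \<longrightarrow> f \<in> Cof M) \<and> (g \<in> Fib M \<longrightarrow> f \<in> Fib M)) \<and>
     (\<forall>i\<in>Cof M. \<forall>p\<in>Fib M. i \<in> Weq M \<or> p \<in> Weq M \<longrightarrow> lifts C i p) \<and>
     (\<forall>f\<in>Arr C. \<exists>i\<in>Cof M. \<exists>p\<in>Fib M \<inter> Weq M. Cod i = Dom p \<and> p \<odot>\<^bsub>C\<^esub> i = f \<and> Dom i = Dom f \<and> Cod p = Cod f) \<and>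
     (\<forall>f\<in>Arr C. \<exists>i\<in>Cof M \<inter> Weq M. \<exists>p\<in>Fib M. Cod i = Dom p \<and> p \<odot>\<^bsub>C\<^esub> i = f \<and> Dom i = Dom f \<and> Cod p = Cod f)"

definition cofibrant :: "('o, 'f) cat \<Rightarrow> ('o, 'f) model \<Rightarrow> 'o \<Rightarrow> bool" where
  "cofibrant C M A \<longleftrightarrow> A \<in> Ob C \<and> (\<exists>I. initial C I \<and> (\<exists>f\<in>hom C I A. f \<in> Cof M))"

definition fibrant :: "('o, 'f) cat \<Rightarrow> ('o, 'f) model \<Rightarrow> 'o \<Rightarrow> bool" where
  "fibrant C M A \<longleftrightarrow> A \<in> Ob C \<and> (\<exists>E. terminal C E \<and> (\<exists>f\<in>hom C A E. f \<in> Fib M))"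

definition quillen_pair :: "('o, 'f) cat \<Rightarrow> ('o, 'f) model \<Rightarrow> ('p, 'g) cat \<Rightarrow> ('p, 'g) model \<Rightarrow>
    ('o, 'f, 'p, 'g) funct \<Rightarrow> ('p, 'g, 'o, 'f) funct \<Rightarrow>
    ('o \<Rightarrow> 'p \<Rightarrow> ('p, 'g) arrow \<Rightarrow> ('o, 'f) arrow) \<Rightarrow> bool" where
  "quillen_pair C M D N F G \<Phi> \<longleftrightarrow>
     adjunction C D F G \<Phi> \<and>
     (\<forall>f\<in>Cof M. far F f \<in> Cof N) \<and>
     (\<forall>f\<in>Cof M \<inter> Weq M. far F f \<in> Cof N \<inter> Weq N)"

definition quillen_equivalence :: "('o, 'f) cat \<Rightarrow> ('o, 'f) model \<Rightarrow> ('p, 'g) cat \<Rightarrow> ('p, 'g) model \<Rightarrow>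
    ('o, 'f, 'p, 'g) funct \<Rightarrow> ('p, 'g, 'o, 'f) funct \<Rightarrow>
    ('o \<Rightarrow> 'p \<Rightarrow> ('p, 'g) arrow \<Rightarrow> ('o, 'f) arrow) \<Rightarrow> bool" where
  "quillen_equivalence C M D N F G \<Phi> \<longleftrightarrow>
     quillen_pair C M D N F G \<Phi> \<and>
     (\<forall>A B. cofibrant C M A \<and> fibrant D N B \<longrightarrow>
        (\<forall>f\<in>hom D (fob F A) B. f \<in> Weq N \<longleftrightarrow> \<Phi> A B f \<in> Weq M))"


section \<open>Spaces\<close>

text \<open>For \<open>n = 0\<close> the disk is a point and its boundary, the sphere of dimension \<open>-1\<close>, is empty.\<close>

definition disk :: "nat \<Rightarrow> (nat \<Rightarrow> real) topology" where
  "disk n = subtopology (Euclidean_space n) {x. (\<Sum>i<n. (x i)\<^sup>2) \<le> 1}"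

definition disk_interior :: "nat \<Rightarrow> (nat \<Rightarrow> real) topology" where
  "disk_interior n = subtopology (Euclidean_space n) {x. (\<Sum>i<n. (x i)\<^sup>2) < 1}"

definition disk_boundary :: "nat \<Rightarrow> (nat \<Rightarrow> real) topology" where
  "disk_boundary n = subtopology (Euclidean_space n) {x. (\<Sum>i<n. (x i)\<^sup>2) = 1}"

text \<open>
  Whitehead's description of CW complexes by characteristic maps: the open cells partition \<open>X\<close>,
  the boundary of a cell meets finitely many cells, all of lower dimension, and \<open>X\<close> carries the
  weak topology. The cells are indexed by \<open>I\<close>, and \<open>d\<close> gives their dimensions.
\<close>

definition CW_complex :: "'u topology \<Rightarrow> bool" where
  "CW_complex X \<longleftrightarrow> Hausdorff_space X \<and>
     (\<exists>(I :: 'u set) (d :: 'u \<Rightarrow> nat) (\<phi> :: 'u \<Rightarrow> (nat \<Rightarrow> real) \<Rightarrow> 'u).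
        let cell = (\<lambda>a. \<phi> a ` topspace (disk_interior (d a))) in
        (\<forall>a\<in>I. continuous_map (disk (d a)) X (\<phi> a)) \<and>
        (\<forall>a\<in>I. embedding_map (disk_interior (d a)) X (\<phi> a)) \<and>
        (\<forall>a\<in>I. \<forall>b\<in>I. a \<noteq> b \<longrightarrow> cell a \<inter> cell b = {}) \<and>
        (\<Union>a\<in>I. cell a) = topspace X \<and>
        (\<forall>a\<in>I. \<exists>J\<subseteq>I. finite J \<and> (\<forall>b\<in>J. d b < d a) \<and>
           \<phi> a ` topspace (disk_boundary (d a)) \<subseteq> (\<Union>b\<in>J. cell b)) \<and>
        (\<forall>A\<subseteq>topspace X.
           (\<forall>a\<in>I. closedin (disk (d a)) {z \<in> topspace (disk (d a)). \<phi> a z \<in> A}) \<longrightarrow> closedin X A))"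

text \<open>Maps are taken to be \<open>undefined\<close> outside their domain, so that arrows are determined by their values.\<close>

definition Top_cat :: "'u topology set \<Rightarrow> ('u topology, 'u \<Rightarrow> 'u) cat" where
  "Top_cat T =
     \<lparr>Ob = T,
      Arr = {Arrow X f Y | X f Y. X \<in> T \<and> Y \<in> T \<and> continuous_map X Y f \<and> f \<in> extensional (topspace X)},
      Ident = (\<lambda>X. Arrow X (\<lambda>x\<in>topspace X. x) X),
      Comp = (\<lambda>g f. Arrow (Dom f) (compose (topspace (Dom f)) (Fn g) (Fn f)) (Cod g))\<rparr>"

definition convenient :: "'u topology set \<Rightarrow> bool" where
  "convenient T \<longleftrightarrow>
     (\<forall>X\<in>T. small TYPE('u) (topspace X)) \<and>
     (\<forall>X\<in>T. \<forall>Y :: 'u topology. X homeomorphic_space Y \<longrightarrow> Y \<in> T) \<and>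
     cartesian_closed (Top_cat T) \<and>
     bicomplete TYPE('u) (Top_cat T) \<and>
     (\<forall>X. CW_complex X \<and> small TYPE('u) (topspace X) \<longrightarrow> X \<in> T)"

text \<open>
  The homotopy set \<open>\<pi>\<^sub>n(X,x)\<close> consists of the homotopy classes of maps of pairs from the disk and
  its boundary to \<open>(X,x)\<close>. The maps induced on homotopy groups are homomorphisms, hence are
  isomorphisms as soon as they are bijective.
\<close>

definition pi_maps :: "nat \<Rightarrow> 'a topology \<Rightarrow> 'a \<Rightarrow> ((nat \<Rightarrow> real) \<Rightarrow> 'a) set" where
  "pi_maps n X x = {u. continuous_map (disk n) X u \<and> (\<forall>z\<in>topspace (disk_boundary n). u z = x)}"

definition pi_rel :: "nat \<Rightarrow> 'a topology \<Rightarrow> 'a \<Rightarrow> (((nat \<Rightarrow> real) \<Rightarrow> 'a) \<times> ((nat \<Rightarrow> real) \<Rightarrow> 'a)) set" where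
  "pi_rel n X x = {(u, v). u \<in> pi_maps n X x \<and> v \<in> pi_maps n X x \<and>
     homotopic_with (\<lambda>h. \<forall>z\<in>topspace (disk_boundary n). h z = x) (disk n) X u v}"

definition homotopy_set :: "nat \<Rightarrow> 'a topology \<Rightarrow> 'a \<Rightarrow> ((nat \<Rightarrow> real) \<Rightarrow> 'a) set set" where
  "homotopy_set n X x = pi_maps n X x // pi_rel n X x"

definition homotopy_set_map :: "nat \<Rightarrow> 'b topology \<Rightarrow> 'b \<Rightarrow> ('a \<Rightarrow> 'b) \<Rightarrow>
    ((nat \<Rightarrow> real) \<Rightarrow> 'a) set \<Rightarrow> ((nat \<Rightarrow> real) \<Rightarrow> 'b) set" where
  "homotopy_set_map n Y y f c = (\<Union>u\<in>c. pi_rel n Y y `` {f \<circ> u})"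

definition weak_homotopy_equivalence :: "'a topology \<Rightarrow> 'b topology \<Rightarrow> ('a \<Rightarrow> 'b) \<Rightarrow> bool" where
  "weak_homotopy_equivalence X Y f \<longleftrightarrow>
     continuous_map X Y f \<and>
     bij_betw (\<lambda>c. \<Union>x\<in>c. path_component_of_set Y (f x)) (path_components_of X) (path_components_of Y) \<and>
     (\<forall>n\<ge>1. \<forall>x\<in>topspace X.
        bij_betw (homotopy_set_map n Y (f x) f) (homotopy_set n X x) (homotopy_set n Y (f x)))"


section \<open>Flows\<close>

text \<open>
  The set of states is identified with the corresponding discrete space. The values of \<open>src\<close> and
  \<open>tgt\<close> outside the path space, and those of \<open>conc\<close> on non-composable pairs, are irrelevant.
\<close>

record 'u flow =
  states :: "'u set"
  paths :: "'u topology"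
  src :: "'u \<Rightarrow> 'u"
  tgt :: "'u \<Rightarrow> 'u"
  conc :: "'u \<Rightarrow> 'u \<Rightarrow> 'u"

definition src_arrow :: "'u flow \<Rightarrow> ('u topology, 'u \<Rightarrow> 'u) arrow" where
  "src_arrow X = Arrow (paths X) (restrict (src X) (topspace (paths X))) (discrete_topology (states X))"

definition tgt_arrow :: "'u flow \<Rightarrow> ('u topology, 'u \<Rightarrow> 'u) arrow" where
  "tgt_arrow X = Arrow (paths X) (restrict (tgt X) (topspace (paths X))) (discrete_topology (states X))"

text \<open>
  The domain of the concatenation carries the topology of the fibre product computed in the
  category of spaces given by \<open>T\<close>, which need not be the subspace topology of the usual product.
\<close>

definition is_flow :: "'u topology set \<Rightarrow> 'u flow \<Rightarrow> bool" where
  "is_flow T X \<longleftrightarrow>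
     small TYPE('u) (states X) \<and> paths X \<in> T \<and>
     continuous_map (paths X) (discrete_topology (states X)) (src X) \<and>
     continuous_map (paths X) (discrete_topology (states X)) (tgt X) \<and>
     (\<forall>x\<in>topspace (paths X). \<forall>y\<in>topspace (paths X). tgt X x = src X y \<longrightarrow>
        conc X x y \<in> topspace (paths X) \<and>
        src X (conc X x y) = src X x \<and> tgt X (conc X x y) = tgt X y) \<and>
     (\<forall>x\<in>topspace (paths X). \<forall>y\<in>topspace (paths X). \<forall>z\<in>topspace (paths X).
        tgt X x = src X y \<and> tgt X y = src X z \<longrightarrow>
        conc X (conc X x y) z = conc X x (conc X y z)) \<and>
     (\<forall>p q. is_pullback (Top_cat T) (tgt_arrow X) (src_arrow X) p q \<longrightarrow>
        continuous_map (Dom p) (paths X) (\<lambda>z. conc X (Fn p z) (Fn q z)))"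

definition is_flow_map :: "'u flow \<Rightarrow> ('u \<Rightarrow> 'u) \<Rightarrow> ('u \<Rightarrow> 'u) \<Rightarrow> 'u flow \<Rightarrow> bool" where
  "is_flow_map X f\<^sub>0 f Y \<longleftrightarrow>
     f\<^sub>0 \<in> states X \<rightarrow>\<^sub>E states Y \<and>
     continuous_map (paths X) (paths Y) f \<and> f \<in> extensional (topspace (paths X)) \<and>
     (\<forall>x\<in>topspace (paths X). src Y (f x) = f\<^sub>0 (src X x) \<and> tgt Y (f x) = f\<^sub>0 (tgt X x)) \<and>
     (\<forall>x\<in>topspace (paths X). \<forall>y\<in>topspace (paths X). tgt X x = src X y \<longrightarrow>
        f (conc X x y) = conc Y (f x) (f y))"

type_synonym 'u flow_arrow = "('u flow, ('u \<Rightarrow> 'u) \<times> ('u \<Rightarrow> 'u)) arrow"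

definition Flow :: "'u topology set \<Rightarrow> ('u flow, ('u \<Rightarrow> 'u) \<times> ('u \<Rightarrow> 'u)) cat" where
  "Flow T =
     \<lparr>Ob = {X. is_flow T X},
      Arr = {Arrow X (f\<^sub>0, f) Y | X f\<^sub>0 f Y. is_flow T X \<and> is_flow T Y \<and> is_flow_map X f\<^sub>0 f Y},
      Ident = (\<lambda>X. Arrow X (\<lambda>a\<in>states X. a, \<lambda>x\<in>topspace (paths X). x) X),
      Comp = (\<lambda>g f. Arrow (Dom f)
                (compose (states (Dom f)) (fst (Fn g)) (fst (Fn f)),
                 compose (topspace (paths (Dom f))) (snd (Fn g)) (snd (Fn f))) (Cod g))\<rparr>"

definition weak_S_homotopy_equivalences :: "'u topology set \<Rightarrow> 'u flow_arrow set" where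
  "weak_S_homotopy_equivalences T =
     {f \<in> Arr (Flow T).
        bij_betw (fst (Fn f)) (states (Dom f)) (states (Cod f)) \<and>
        weak_homotopy_equivalence (paths (Dom f)) (paths (Cod f)) (snd (Fn f))}"

definition Glob :: "'u topology \<Rightarrow> 'u flow" where
  "Glob Z = \<lparr>states = {code False, code True}, paths = Z,
             src = (\<lambda>x. code False), tgt = (\<lambda>x. code True), conc = (\<lambda>x y. undefined)\<rparr>"

definition set_flow :: "'u set \<Rightarrow> 'u flow" where
  "set_flow S = \<lparr>states = S, paths = discrete_topology {},
                 src = (\<lambda>x. undefined), tgt = (\<lambda>x. undefined), conc = (\<lambda>x y. undefined)\<rparr>"

definition flow_generators :: "'u flow_arrow set" where
  "flow_generators =
     {Arrow (Glob (code_top (disk_boundary n)))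
        (\<lambda>a\<in>{code False, code True}. a, \<lambda>x\<in>topspace (code_top (disk_boundary n)). x)
        (Glob (code_top (disk n))) | n. True} \<union>
     {Arrow (set_flow {}) (\<lambda>a. undefined, \<lambda>x. undefined) (set_flow {code ()}),
      Arrow (set_flow {code False, code True}) (\<lambda>a\<in>{code False, code True}. code (), \<lambda>x. undefined)
        (set_flow {code ()})}"

definition Flow_model :: "'u topology set \<Rightarrow> ('u flow, ('u \<Rightarrow> 'u) \<times> ('u \<Rightarrow> 'u)) model" where
  "Flow_model T =
     (let W = weak_S_homotopy_equivalences T;
          C = llp (Flow T) (rlp (Flow T) flow_generators)
      in \<lparr>Weq = W, Cof = C, Fib = rlp (Flow T) (C \<inter> W)\<rparr>)"


section \<open>Precubical sets\<close>

definition cube :: "nat \<Rightarrow> bool list set" where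
  "cube n = {x. length x = n}"

definition face :: "nat \<Rightarrow> nat \<Rightarrow> bool \<Rightarrow> (nat, bool list \<Rightarrow> bool list) arrow" where
  "face n i e = Arrow n (\<lambda>x\<in>cube n. take i x @ e # drop i x) (Suc n)"

definition cube_comp :: "(nat, bool list \<Rightarrow> bool list) arrow \<Rightarrow> (nat, bool list \<Rightarrow> bool list) arrow \<Rightarrow>
    (nat, bool list \<Rightarrow> bool list) arrow" where
  "cube_comp g f = Arrow (Dom f) (compose (cube (Dom f)) (Fn g) (Fn f)) (Cod g)"

inductive_set box_arrows :: "(nat, bool list \<Rightarrow> bool list) arrow set" where
  box_ident: "Arrow n (\<lambda>x\<in>cube n. x) n \<in> box_arrows"
| box_face: "f \<in> box_arrows \<Longrightarrow> i \<le> Cod f \<Longrightarrow> cube_comp (face (Cod f) i e) f \<in> box_arrows"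

definition Box :: "(nat, bool list \<Rightarrow> bool list) cat" where
  "Box = \<lparr>Ob = UNIV, Arr = box_arrows, Ident = (\<lambda>n. Arrow n (\<lambda>x\<in>cube n. x) n), Comp = cube_comp\<rparr>"

definition Set_cat :: "('u set, 'u \<Rightarrow> 'u) cat" where
  "Set_cat =
     \<lparr>Ob = {A. small TYPE('u) A},
      Arr = {Arrow A f B | A f B. small TYPE('u) A \<and> small TYPE('u) B \<and> f \<in> A \<rightarrow>\<^sub>E B},
      Ident = (\<lambda>A. Arrow A (\<lambda>x\<in>A. x) A),
      Comp = (\<lambda>g f. Arrow (Dom f) (compose (Dom f) (Fn g) (Fn f)) (Cod g))\<rparr>"

type_synonym 'u prsh = "(nat, bool list \<Rightarrow> bool list, 'u set, 'u \<Rightarrow> 'u) funct"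
type_synonym 'u prsh_arrow = "('u prsh, nat \<Rightarrow> ('u set, 'u \<Rightarrow> 'u) arrow) arrow"

definition PrSh :: "('u prsh, nat \<Rightarrow> ('u set, 'u \<Rightarrow> 'u) arrow) cat" where
  "PrSh = functor_cat (op_cat Box) Set_cat"

definition rep :: "nat \<Rightarrow> 'u prsh" where
  "rep n = \<lparr>fob = (\<lambda>m. code ` hom Box m n),
            far = (\<lambda>a. Arrow (code ` hom Box (Dom a) n)
                         (\<lambda>z\<in>code ` hom Box (Dom a) n. code (cube_comp (decode z) (op_arrow a)))
                         (code ` hom Box (Cod a) n))\<rparr>"

definition rep_map :: "(nat, bool list \<Rightarrow> bool list) arrow \<Rightarrow> 'u prsh_arrow" where
  "rep_map f = Arrow (rep (Dom f))
     (\<lambda>m. Arrow (code ` hom Box m (Dom f))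
            (\<lambda>z\<in>code ` hom Box m (Dom f). code (cube_comp f (decode z)))
            (code ` hom Box m (Cod f)))
     (rep (Cod f))"

definition rep_boundary :: "nat \<Rightarrow> 'u prsh" where
  "rep_boundary n =
     (let K = (\<lambda>m. if m < n then fob (rep n) m else {})
      in \<lparr>fob = K, far = (\<lambda>a. Arrow (K (Dom a)) (restrict (Fn (far (rep n) a)) (K (Dom a))) (K (Cod a)))\<rparr>)"

definition boundary_inclusion :: "nat \<Rightarrow> 'u prsh_arrow" where
  "boundary_inclusion n = Arrow (rep_boundary n)
     (\<lambda>m. Arrow (fob (rep_boundary n) m) (\<lambda>z\<in>fob (rep_boundary n) m. z) (fob (rep n) m)) (rep n)"

text \<open>The morphism from the representable presheaf to \<open>K\<close> corresponding to an \<open>n\<close>-cube \<open>x\<close> of \<open>K\<close>.\<close>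

definition yoneda :: "'u prsh \<Rightarrow> nat \<Rightarrow> 'u \<Rightarrow> 'u prsh_arrow" where
  "yoneda K n x = Arrow (rep n)
     (\<lambda>m. Arrow (fob (rep n) m)
            (\<lambda>z\<in>fob (rep n) m. Fn (far K (op_arrow (decode z))) x)
            (fob K m))
     K"

definition cube_cat :: "'u prsh \<Rightarrow> (nat \<times> 'u prsh_arrow, bool list \<Rightarrow> bool list) cat" where
  "cube_cat K =
     \<lparr>Ob = {(n, \<sigma>). \<sigma> \<in> hom PrSh (rep n) K},
      Arr = {Arrow (m, \<sigma>) f (n, \<tau>) | m \<sigma> f n \<tau>.
               \<sigma> \<in> hom PrSh (rep m) K \<and> \<tau> \<in> hom PrSh (rep n) K \<and>
               Arrow m f n \<in> Arr Box \<and> \<tau> \<odot>\<^bsub>PrSh\<^esub> rep_map (Arrow m f n) = \<sigma>},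
      Ident = (\<lambda>(n, \<sigma>). Arrow (n, \<sigma>) (\<lambda>x\<in>cube n. x) (n, \<sigma>)),
      Comp = (\<lambda>g f. Arrow (Dom f) (compose (cube (fst (Dom f))) (Fn g) (Fn f)) (Cod g))\<rparr>"


section \<open>Realization functors\<close>

definition poset_flow :: "'a set \<Rightarrow> ('a \<Rightarrow> 'a \<Rightarrow> bool) \<Rightarrow> 'u flow" where
  "poset_flow A lt =
     \<lparr>states = code ` A,
      paths = discrete_topology (code ` {(x, y). x \<in> A \<and> y \<in> A \<and> lt x y}),
      src = (\<lambda>p. code (fst (decode p :: 'a \<times> 'a))),
      tgt = (\<lambda>p. code (snd (decode p :: 'a \<times> 'a))),
      conc = (\<lambda>p q. code (fst (decode p :: 'a \<times> 'a), snd (decode q :: 'a \<times> 'a)))\<rparr>"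

definition cube_less :: "bool list \<Rightarrow> bool list \<Rightarrow> bool" where
  "cube_less x y \<longleftrightarrow> list_all2 (\<le>) x y \<and> x \<noteq> y"

definition cube_flow :: "(nat, bool list \<Rightarrow> bool list, 'u flow, ('u \<Rightarrow> 'u) \<times> ('u \<Rightarrow> 'u)) funct" where
  "cube_flow =
     (let Q = (\<lambda>n. poset_flow (cube n) cube_less)
      in \<lparr>fob = Q,
          far = (\<lambda>f. Arrow (Q (Dom f))
                  (\<lambda>a\<in>states (Q (Dom f)). code (Fn f (decode a)),
                   \<lambda>p\<in>topspace (paths (Q (Dom f))).
                     code (map_prod (Fn f) (Fn f) (decode p)))
                  (Q (Cod f)))\<rparr>)"

definition cube_diagram :: "(nat, bool list \<Rightarrow> bool list, 'u flow, ('u \<Rightarrow> 'u) \<times> ('u \<Rightarrow> 'u)) funct \<Rightarrow>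
    (nat \<times> 'u prsh_arrow, bool list \<Rightarrow> bool list, 'u flow, ('u \<Rightarrow> 'u) \<times> ('u \<Rightarrow> 'u)) funct" where
  "cube_diagram X = \<lparr>fob = (\<lambda>(n, \<sigma>). fob X n),
                     far = (\<lambda>a. far X (Arrow (fst (Dom a)) (Fn a) (fst (Cod a))))\<rparr>"

type_synonym 'u real_functor =
  "('u prsh, nat \<Rightarrow> ('u set, 'u \<Rightarrow> 'u) arrow, 'u flow, ('u \<Rightarrow> 'u) \<times> ('u \<Rightarrow> 'u)) funct"

text \<open>
  The functor \<open>L\<close> computes the colimits over the categories of cubes, for some choice \<open>\<iota>\<close> of
  colimit cocones, and acts on morphisms by the induced maps between these colimits.
\<close>

definition extends_cocubical :: "'u topology set \<Rightarrow>
    (nat, bool list \<Rightarrow> bool list, 'u flow, ('u \<Rightarrow> 'u) \<times> ('u \<Rightarrow> 'u)) funct \<Rightarrow> 'u real_functor \<Rightarrow> bool" where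
  "extends_cocubical T X L \<longleftrightarrow>
     is_functor PrSh (Flow T) L \<and>
     (\<exists>\<iota>. (\<forall>K\<in>Ob PrSh. is_colimit (cube_cat K) (Flow T) (cube_diagram X) (fob L K) (\<iota> K)) \<and>
          (\<forall>f\<in>Arr PrSh. \<forall>(n, \<sigma>)\<in>Ob (cube_cat (Dom f)).
             far L f \<odot>\<^bsub>Flow T\<^esub> \<iota> (Dom f) (n, \<sigma>) = \<iota> (Cod f) (n, f \<odot>\<^bsub>PrSh\<^esub> \<sigma>)))"

definition realization_functor :: "'u topology set \<Rightarrow> 'u real_functor \<Rightarrow> bool" where
  "realization_functor T L \<longleftrightarrow>
     (\<exists>X. is_functor Box (Flow T) X \<and>
          (\<exists>\<eta>. nat_trans Box (Flow T) X cube_flow \<eta> \<and>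
               (\<forall>n. \<eta> n \<in> weak_S_homotopy_equivalences T)) \<and>
          extends_cocubical T X L) \<and>
     (\<forall>n. far L (boundary_inclusion n) \<in> Cof (Flow_model T))"

text \<open>The right adjoint of \<open>L\<close>: its \<open>n\<close>-cubes on \<open>Y\<close> are (codes of) morphisms from \<open>L(\<box>[n])\<close> to \<open>Y\<close>.\<close>

definition nerve_hom :: "'u topology set \<Rightarrow> 'u real_functor \<Rightarrow> 'u flow \<Rightarrow> nat \<Rightarrow> 'u flow_arrow set" where
  "nerve_hom T L Y n = hom (Flow T) (fob L (rep n)) Y"

definition nerve_code :: "'u topology set \<Rightarrow> 'u real_functor \<Rightarrow> 'u flow \<Rightarrow> nat \<Rightarrow> 'u flow_arrow \<Rightarrow> 'u" where
  "nerve_code T L Y n = code_on (nerve_hom T L Y n)"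

definition nerve_decode :: "'u topology set \<Rightarrow> 'u real_functor \<Rightarrow> 'u flow \<Rightarrow> nat \<Rightarrow> 'u \<Rightarrow> 'u flow_arrow" where
  "nerve_decode T L Y n = inv_into (nerve_hom T L Y n) (nerve_code T L Y n)"

definition nerve_ob :: "'u topology set \<Rightarrow> 'u real_functor \<Rightarrow> 'u flow \<Rightarrow> 'u prsh" where
  "nerve_ob T L Y =
     (let N = (\<lambda>n. nerve_code T L Y n ` nerve_hom T L Y n)
      in \<lparr>fob = N,
          far = (\<lambda>a. Arrow (N (Dom a))
                  (\<lambda>z\<in>N (Dom a). nerve_code T L Y (Cod a)
                     (nerve_decode T L Y (Dom a) z \<odot>\<^bsub>Flow T\<^esub> far L (rep_map (op_arrow a))))
                  (N (Cod a)))\<rparr>)"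

definition nerve :: "'u topology set \<Rightarrow> 'u real_functor \<Rightarrow>
    ('u flow, ('u \<Rightarrow> 'u) \<times> ('u \<Rightarrow> 'u), 'u prsh, nat \<Rightarrow> ('u set, 'u \<Rightarrow> 'u) arrow) funct" where
  "nerve T L =
     \<lparr>fob = nerve_ob T L,
      far = (\<lambda>g. Arrow (nerve_ob T L (Dom g))
               (\<lambda>n. Arrow (fob (nerve_ob T L (Dom g)) n)
                      (\<lambda>z\<in>fob (nerve_ob T L (Dom g)) n.
                         nerve_code T L (Cod g) n (g \<odot>\<^bsub>Flow T\<^esub> nerve_decode T L (Dom g) n z))
                      (fob (nerve_ob T L (Cod g)) n))
               (nerve_ob T L (Cod g)))\<rparr>"

text \<open>The adjunct of \<open>f : L(K) \<rightarrow> Y\<close> sends a cube \<open>\<box>[n] \<rightarrow> K\<close> to the composite \<open>L(\<box>[n]) \<rightarrow> L(K) \<rightarrow> Y\<close>.\<close>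

definition nerve_adjunct :: "'u topology set \<Rightarrow> 'u real_functor \<Rightarrow>
    'u prsh \<Rightarrow> 'u flow \<Rightarrow> 'u flow_arrow \<Rightarrow> 'u prsh_arrow" where
  "nerve_adjunct T L K Y f = Arrow K
     (\<lambda>n. Arrow (fob K n)
            (\<lambda>x\<in>fob K n. nerve_code T L Y n (f \<odot>\<^bsub>Flow T\<^esub> far L (yoneda K n x)))
            (fob (nerve_ob T L Y) n))
     (nerve_ob T L Y)"

end

theory Submission
  imports Defs
begin

text \<open>
  Counting coordinates that change from 0 to 1 is additive along concatenation and invariant under
  faces, so it gives every realization a length: a morphism to the one-state flow of positive
  integers under addition. The length of a path is locally constant, but a loop \<open>x\<close> and its double
  \<open>x * x\<close> have different lengths. Hence a realization is never weakly equivalent to the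
  terminal flow, whereas under a Quillen equivalence the realization of a cofibrant replacement of
  the nerve of the terminal flow would be.
\<close>

section \<open>Coding\<close>

lemma small_lepoll:
  assumes "A \<lesssim> B" "small U B"
  shows "small U A"
  using assms unfolding small_def by (meson lepoll_trans1 lesspoll_trans1)

lemma universe_small_countable:
  assumes "universe U" "countable A"
  shows "small U A"
proof -
  have "A \<lesssim> (UNIV :: nat set)"
    using assms(2) by (simp add: countable_lepoll lepoll_def countable_def)
  then show ?thesis
    using assms(1) small_lepoll unfolding universe_def by blast
qed

text \<open>\<open>code\<close> is chosen among injections and means something only once one exists.
  Booleans, lists, pairs and naturals form countable types, which are small in any universe.\<close>

lemma inj_code:
  assumes "universe TYPE('u)"
  shows "inj (code :: 'a::countable \<Rightarrow> 'u)"
proof -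
  have "small TYPE('u) (UNIV :: 'a set)"
    by (simp add: universe_small_countable[OF assms])
  then have "\<exists>f. inj (f :: 'a \<Rightarrow> 'u)"
    unfolding small_def lesspoll_def lepoll_def by auto
  then show ?thesis
    unfolding code_def code_on_def by (rule someI_ex)
qed

lemma decode_code:
  assumes "universe TYPE('u)"
  shows "decode (code x :: 'u) = (x :: 'a::countable)"
  unfolding decode_def by (rule inv_f_f[OF inj_code[OF assms]])


section \<open>Flows with one state and discrete path space\<close>

text \<open>A product of discrete spaces is discrete, so every function out of it is continuous.
  Continuity is deduced from \<open>f\<close> and \<open>g\<close> alone because the topology of
  \<open>P\<close> will be that of an arbitrary pullback in the category of spaces.\<close>

lemma continuous_map_discrete2:
  assumes "continuous_map P (discrete_topology A) f" "continuous_map P (discrete_topology B) g"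
    and "\<And>z. z \<in> topspace P \<Longrightarrow> m (f z) (g z) \<in> C"
  shows "continuous_map P (discrete_topology C) (\<lambda>z. m (f z) (g z))"
proof -
  have "continuous_map P (prod_topology (discrete_topology A) (discrete_topology B)) (\<lambda>z. (f z, g z))"
    using assms by (simp add: continuous_map_pairedI)
  then have c: "continuous_map P (discrete_topology (A \<times> B)) (\<lambda>z. (f z, g z))"
    by (simp add: prod_topology_discrete_topology)
  have "openin P {z \<in> topspace P. m (f z) (g z) \<in> U}" for U
  proof -
    have "{z \<in> topspace P. m (f z) (g z) \<in> U} =
        {z \<in> topspace P. (f z, g z) \<in> {w \<in> A \<times> B. m (fst w) (snd w) \<in> U}}"
      using continuous_map_funspace[OF c] by auto
    moreover have "openin P \<dots>"
      by (rule openin_continuous_map_preimage[OF c]) auto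
    ultimately show ?thesis by simp
  qed
  then show ?thesis
    using assms(3) by (auto simp: continuous_map_def)
qed

section \<open>Discrete spaces as CW complexes\<close>

lemma topspace_disk_0: "topspace (disk 0) = {\<lambda>_. 0}"
  unfolding disk_def by (auto simp: topspace_Euclidean_space)

lemma topspace_disk_interior_0: "topspace (disk_interior 0) = {\<lambda>_. 0}"
  unfolding disk_interior_def by (auto simp: topspace_Euclidean_space)

lemma topspace_disk_boundary_0: "topspace (disk_boundary 0) = {}"
  unfolding disk_boundary_def by auto

lemma CW_complex_discrete: "CW_complex (discrete_topology (S :: 'u set))"
proof -
  have emb: "embedding_map (disk_interior 0) (discrete_topology S) (\<lambda>_. a)" if "a \<in> S" for a
  proof (rule injective_open_imp_embedding_map)
    show "continuous_map (disk_interior 0) (discrete_topology S) (\<lambda>_. a)"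
      using that by simp
    show "open_map (disk_interior 0) (discrete_topology S) (\<lambda>_. a)"
      using that by (auto simp: open_map_def)
    show "inj_on (\<lambda>_. a) (topspace (disk_interior 0))"
      by (simp add: topspace_disk_interior_0)
  qed
  show ?thesis
    unfolding CW_complex_def Let_def
    \<comment> \<open>One 0-cell for each point, indexed by the point itself. The boundary of the
      0-disk is empty, so no cells are needed to cover its image.\<close>
    by (intro conjI exI[of _ S] exI[of _ "\<lambda>_. 0"] exI[of _ "\<lambda>a _. a"])
      (auto simp: emb topspace_disk_interior_0 topspace_disk_boundary_0 Hausdorff_space_discrete_topology
        intro: exI[of _ "{}"])
qed

lemma convenient_discrete:
  assumes "convenient T" "small TYPE('u) (S :: 'u set)"
  shows "discrete_topology S \<in> T"
proof -
  have "\<forall>X. CW_complex X \<and> small TYPE('u) (topspace X) \<longrightarrow> X \<in> T"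
    using assms(1) unfolding convenient_def by (elim conjE)
  then show ?thesis
    using assms(2) CW_complex_discrete[of S] by simp
qed

text \<open>A flow with one state is a semigroup in spaces, as all its paths are composable loops.
  The terminal flow and the target of the length are both of this kind.\<close>

definition semigroup_flow :: "'u \<Rightarrow> 'u set \<Rightarrow> ('u \<Rightarrow> 'u \<Rightarrow> 'u) \<Rightarrow> 'u flow" where
  "semigroup_flow b S m =
     \<lparr>states = {b}, paths = discrete_topology S, src = (\<lambda>_. b), tgt = (\<lambda>_. b), conc = m\<rparr>"

lemma Top_cat_hom_iff:
  "f \<in> hom (Top_cat T) X Y \<longleftrightarrow>
     Dom f = X \<and> Cod f = Y \<and> X \<in> T \<and> Y \<in> T \<and>
     continuous_map X Y (Fn f) \<and> Fn f \<in> extensional (topspace X)"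
  unfolding hom_def Top_cat_def by (cases f) auto

lemma is_pullback_homs:
  assumes "is_pullback C f g p q"
  shows "p \<in> hom C (Dom p) (Dom f)" "q \<in> hom C (Dom p) (Dom g)"
  by (rule assms[unfolded is_pullback_def, THEN conjunct1]
      assms[unfolded is_pullback_def, THEN conjunct2, THEN conjunct1])+

lemma is_flow_semigroup_flow:
  assumes "universe TYPE('u)" "convenient T" "small TYPE('u) (S :: 'u set)"
    and m: "\<And>x y. x \<in> S \<Longrightarrow> y \<in> S \<Longrightarrow> m x y \<in> S"
    and assoc: "\<And>x y z. x \<in> S \<Longrightarrow> y \<in> S \<Longrightarrow> z \<in> S \<Longrightarrow> m (m x y) z = m x (m y z)"
  shows "is_flow T (semigroup_flow b S m)"
proof -
  let ?X = "semigroup_flow b S m"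
  have simps [simp]: "states ?X = {b}" "paths ?X = discrete_topology S"
      "src ?X = (\<lambda>_. b)" "tgt ?X = (\<lambda>_. b)" "conc ?X = m"
    by (simp_all add: semigroup_flow_def)
  have "continuous_map (Dom p) (discrete_topology S) (\<lambda>z. m (Fn p z) (Fn q z))"
    if "is_pullback (Top_cat T) (tgt_arrow ?X) (src_arrow ?X) p q" for p q
  proof -
    \<comment> \<open>Both legs of a pullback are continuous, whatever topology its vertex
      carries.\<close>
    have p: "continuous_map (Dom p) (discrete_topology S) (Fn p)"
      and q: "continuous_map (Dom p) (discrete_topology S) (Fn q)"
      using is_pullback_homs[OF that] by (simp_all add: Top_cat_hom_iff tgt_arrow_def src_arrow_def)
    show ?thesis
      using p q by (intro continuous_map_discrete2[where m = m, OF p q] m) (auto simp: continuous_map_def)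
  qed
  moreover have "small TYPE('u) {b}"
    by (simp add: universe_small_countable[OF assms(1)])
  ultimately show ?thesis
    using convenient_discrete[OF assms(2,3)] unfolding is_flow_def simps
    by (intro conjI ballI impI allI) (simp_all add: m assoc)
qed

section \<open>Morphisms of flows and their composition\<close>

lemma Flow_arrow_iff:
  "f \<in> hom (Flow T) X Y \<longleftrightarrow>
     Dom f = X \<and> Cod f = Y \<and> is_flow T X \<and> is_flow T Y \<and>
     is_flow_map X (fst (Fn f)) (snd (Fn f)) Y"
  unfolding hom_def Flow_def by (cases f) auto

lemma is_flow_states:
  assumes "is_flow T X" "x \<in> topspace (paths X)"
  shows "src X x \<in> states X" "tgt X x \<in> states X"
proof -
  have "continuous_map (paths X) (discrete_topology (states X)) (src X)"
    "continuous_map (paths X) (discrete_topology (states X)) (tgt X)"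
    using assms(1) unfolding is_flow_def by blast+
  then show "src X x \<in> states X" "tgt X x \<in> states X"
    using assms(2) by (simp_all add: continuous_map_def Pi_iff)
qed

lemma is_flow_map_paths:
  assumes "is_flow_map X f\<^sub>0 f Y" "x \<in> topspace (paths X)"
  shows "f x \<in> topspace (paths Y)"
proof -
  have "continuous_map (paths X) (paths Y) f"
    using assms(1) unfolding is_flow_map_def by blast
  then show ?thesis
    using assms(2) by (simp_all add: continuous_map_def Pi_iff)
qed

lemma Flow_comp_hom:
  assumes "f \<in> hom (Flow T) X Y" "g \<in> hom (Flow T) Y Z"
  shows "g \<odot>\<^bsub>Flow T\<^esub> f \<in> hom (Flow T) X Z"
proof -
  note f = assms(1)[unfolded Flow_arrow_iff] and g = assms(2)[unfolded Flow_arrow_iff]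
  have X: "is_flow T X"
    using f by blast
  have df: "Dom f = X" "Cod g = Z"
    using assms by (auto simp: hom_def)
  have fp: "is_flow_map X (fst (Fn f)) (snd (Fn f)) Y" and gp: "is_flow_map Y (fst (Fn g)) (snd (Fn g)) Z"
    using f g by auto
  have cf: "snd (Fn f) x \<in> topspace (paths Y)" if "x \<in> topspace (paths X)" for x
    using is_flow_map_paths[OF fp that] .
  have cX: "conc X x y \<in> topspace (paths X)"
    if "x \<in> topspace (paths X)" "y \<in> topspace (paths X)" "tgt X x = src X y" for x y
    using X that unfolding is_flow_def by blast
  note sX = is_flow_states[OF X]
  have "continuous_map (paths X) (paths Z) (snd (Fn g) \<circ> snd (Fn f))"
    using fp gp unfolding is_flow_map_def by (blast intro: continuous_map_compose)
  \<comment> \<open>\<open>compose\<close> agrees with the plain composite on the path space, and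
    continuity sees no other values.\<close>
  then have "continuous_map (paths X) (paths Z) (compose (topspace (paths X)) (snd (Fn g)) (snd (Fn f)))"
    by (rule continuous_map_eq) (simp add: compose_def)
  then have "is_flow_map X (compose (states X) (fst (Fn g)) (fst (Fn f)))
      (compose (topspace (paths X)) (snd (Fn g)) (snd (Fn f))) Z"
    using fp gp cf cX sX unfolding is_flow_map_def by (auto simp: compose_def PiE_iff Pi_iff)
  then show ?thesis
    using f g unfolding Flow_arrow_iff by (auto simp: Flow_def df)
qed

text \<open>Since \<open>compose\<close> cuts a function down to its domain, associativity amounts
  to \<open>f\<close> sending states and paths of \<open>X\<close> into those of the domain of
  \<open>g\<close>.\<close>

lemma Flow_comp_assoc:
  assumes "f \<in> hom (Flow T) X Y" "Dom g = Y"
  shows "(h \<odot>\<^bsub>Flow T\<^esub> g) \<odot>\<^bsub>Flow T\<^esub> f = h \<odot>\<^bsub>Flow T\<^esub> (g \<odot>\<^bsub>Flow T\<^esub> f)"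
proof -
  have "fst (Fn f) \<in> states X \<rightarrow> states Y" "snd (Fn f) \<in> topspace (paths X) \<rightarrow> topspace (paths Y)"
    "Dom f = X"
    using assms(1) is_flow_map_paths[of X "fst (Fn f)" "snd (Fn f)" Y]
    unfolding Flow_arrow_iff is_flow_map_def by blast+
  then show ?thesis
    using assms(2) by (auto simp: Flow_def compose_def fun_eq_iff Pi_iff)
qed


section \<open>The terminal flow\<close>

text \<open>The terminal flow carries a loop at its one state, since paths of any flow need an
  image; it differs from the one-state flow with empty path space.\<close>

definition unit_flow :: "'u flow" where
  "unit_flow = semigroup_flow (code ()) {code ()} (\<lambda>_ _. code ())"

lemma terminal_unit_flow:
  assumes "universe TYPE('u)" "convenient T"
  shows "terminal (Flow T) (unit_flow :: 'u flow)"
proof -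
  let ?E = "unit_flow :: 'u flow"
  have E: "is_flow T ?E"
    unfolding unit_flow_def using assms
    by (intro is_flow_semigroup_flow) (auto simp: universe_small_countable)
  have E_simps: "states ?E = {code ()}" "paths ?E = discrete_topology {code ()}"
      "src ?E = (\<lambda>_. code ())" "tgt ?E = (\<lambda>_. code ())" "conc ?E = (\<lambda>_ _. code ())"
    by (simp_all add: unit_flow_def semigroup_flow_def)
  have "\<exists>!f. f \<in> hom (Flow T) X ?E" if X: "is_flow T X" for X
  proof
    let ?f = "Arrow X (\<lambda>a\<in>states X. code (), \<lambda>x\<in>topspace (paths X). code ()) ?E"
    have "continuous_map (paths X) (discrete_topology {code ()}) (\<lambda>x\<in>topspace (paths X). code ())"
      by (rule continuous_map_eq[where f = "\<lambda>_. code ()"]) auto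
    then show "?f \<in> hom (Flow T) X ?E"
      using X E is_flow_states[OF X] unfolding Flow_arrow_iff is_flow_map_def
      by (auto simp: E_simps is_flow_def)
    fix f
    assume "f \<in> hom (Flow T) X ?E"
    then have f: "Dom f = X" "Cod f = ?E" and fm: "is_flow_map X (fst (Fn f)) (snd (Fn f)) ?E"
      unfolding Flow_arrow_iff by blast+
    have f0: "fst (Fn f) \<in> states X \<rightarrow>\<^sub>E {code ()}"
      and fp: "snd (Fn f) \<in> extensional (topspace (paths X))"
      using fm[unfolded is_flow_map_def E_simps] by blast+
    have "fst (Fn f) = (\<lambda>a\<in>states X. code ())"
      using f0 by (auto simp: fun_eq_iff PiE_iff extensional_def)
    moreover have "snd (Fn f) = (\<lambda>x\<in>topspace (paths X). code ())"
      using fp is_flow_map_paths[OF fm] by (auto simp: E_simps fun_eq_iff extensional_def)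
    ultimately show "f = ?f"
      using f(1,2) by (cases f) (auto simp: prod_eq_iff)
  qed
  then show ?thesis
    using E unfolding terminal_def by (simp add: Flow_def)
qed

text \<open>Morphisms into a terminal object are unique, so in a lifting square against
  \<open>e\<close> the bottom map \<open>v\<close> is itself a lift and both triangles
  commute.\<close>

lemma fibrant_unit_flow:
  assumes "universe TYPE('u)" "convenient T"
  shows "fibrant (Flow T) (Flow_model T) (unit_flow :: 'u flow)"
proof -
  let ?E = "unit_flow :: 'u flow"
  note t = terminal_unit_flow[OF assms]
  obtain e where e: "e \<in> hom (Flow T) ?E ?E"
    using t unfolding terminal_def by blast
  have uniq: "f = g" if "f \<in> hom (Flow T) X ?E" "g \<in> hom (Flow T) X ?E" for f g X
  proof -
    have "X \<in> Ob (Flow T)"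
      using that(1) unfolding Flow_arrow_iff by (simp add: Flow_def)
    then show ?thesis
      using t that unfolding terminal_def by blast
  qed
  have "lifts (Flow T) i e" if i: "i \<in> Arr (Flow T)" for i
    unfolding lifts_def
  proof (intro ballI impI)
    fix u v
    assume u: "u \<in> hom (Flow T) (Dom i) (Dom e)" and v: "v \<in> hom (Flow T) (Cod i) (Cod e)"
    have i': "i \<in> hom (Flow T) (Dom i) (Cod i)"
      using i by (simp add: hom_def)
    have E: "Dom e = ?E" "Cod e = ?E"
      using e by (auto simp: hom_def)
    show "\<exists>h\<in>hom (Flow T) (Cod i) (Dom e). h \<odot>\<^bsub>Flow T\<^esub> i = u \<and> e \<odot>\<^bsub>Flow T\<^esub> h = v"
    proof (intro bexI conjI)
      show v': "v \<in> hom (Flow T) (Cod i) (Dom e)"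
        using v unfolding E .
      show "v \<odot>\<^bsub>Flow T\<^esub> i = u"
        using uniq Flow_comp_hom[OF i' v'] u unfolding E by blast
      show "e \<odot>\<^bsub>Flow T\<^esub> v = v"
        using uniq Flow_comp_hom[OF v'[unfolded E] e] v unfolding E by blast
    qed
  qed
  then have "e \<in> Fib (Flow_model T)"
    using e unfolding Flow_model_def Let_def rlp_def llp_def by (auto simp: hom_def)
  then show ?thesis
    using t e unfolding fibrant_def terminal_def by blast
qed


section \<open>The length of a path of a realization\<close>

text \<open>The additive semigroup of positive integers. Zero is left out so that no element is
  idempotent, which rules out a loop having the same length as its double.\<close>

definition length_flow :: "'u flow" where
  "length_flow = semigroup_flow (code ()) (code ` {0::nat<..})
     (\<lambda>x y. code (decode x + decode y :: nat))"

lemma is_flow_length_flow: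
  assumes "universe TYPE('u)" "convenient T"
  shows "is_flow T (length_flow :: 'u flow)"
  unfolding length_flow_def
proof (rule is_flow_semigroup_flow[OF assms])
  show "small TYPE('u) (code ` {0::nat<..})"
    by (simp add: universe_small_countable[OF assms(1)])
next
  fix x y z :: 'u
  assume "x \<in> code ` {0::nat<..}" "y \<in> code ` {0::nat<..}"
  then obtain a b :: nat where ab: "x = code a" "y = code b" "a > 0" "b > 0"
    by (elim imageE) simp
  then show "code (decode x + decode y :: nat) \<in> code ` {0::nat<..}"
    by (intro imageI) (simp add: decode_code[OF assms(1)])
  show "(code (decode (code (decode x + decode y :: nat) :: 'u) + decode z :: nat) :: 'u) =
      code (decode x + decode (code (decode y + decode z :: nat) :: 'u) :: nat)"
    by (simp add: decode_code[OF assms(1)] add.assoc)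
qed

text \<open>The rank function of the poset of vertices of a cube.\<close>

definition ones :: "bool list \<Rightarrow> nat" where
  "ones x = length (filter id x)"

lemma ones_le: "list_all2 (\<le>) x y \<Longrightarrow> ones x \<le> ones y"
proof (induction rule: list_all2_induct)
  case (Cons a x b y)
  then show ?case
    by (cases a; cases b) (simp_all add: ones_def)
qed simp

text \<open>A strict step raises some coordinate and lowers none. This makes lengths positive and
  keeps the truncated subtraction of naturals exact, so that lengths add up.\<close>

lemma ones_less:
  assumes "cube_less x y"
  shows "ones x < ones y"
proof -
  have "list_all2 (\<le>) x y \<Longrightarrow> x \<noteq> y \<Longrightarrow> ones x < ones y"
  proof (induction rule: list_all2_induct)
    case (Cons a x b y)
    then show ?case
      using ones_le[of x y] by (cases "x = y") (auto simp: ones_def)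
  qed simp
  then show ?thesis
    using assms unfolding cube_less_def by blast
qed

text \<open>Differences of ranks are compared, not ranks: a face inserting a 1 raises the rank of
  both ends by one. The condition is stable under composition, so it passes from faces to all
  morphisms of \<open>Box\<close>.\<close>

definition preserves_length :: "(nat, bool list \<Rightarrow> bool list) arrow \<Rightarrow> bool" where
  "preserves_length f \<longleftrightarrow>
     (\<forall>x\<in>cube (Dom f). Fn f x \<in> cube (Cod f)) \<and>
     (\<forall>x\<in>cube (Dom f). \<forall>y\<in>cube (Dom f). cube_less x y \<longrightarrow>
        cube_less (Fn f x) (Fn f y) \<and> ones (Fn f y) - ones (Fn f x) = ones y - ones x)"

lemma preserves_length_face:
  assumes "i \<le> n"
  shows "preserves_length (face n i e)"
proof -
  have less: "cube_less (take i x @ e # drop i x) (take i y @ e # drop i y)"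
    if "length x = n" "length y = n" "cube_less x y" for x y
  proof -
    have "list_all2 (\<le>) (take i x @ e # drop i x) (take i y @ e # drop i y)"
      using that unfolding cube_less_def
      by (auto intro!: list_all2_appendI list_all2_takeI list_all2_dropI)
    moreover have "take i x @ e # drop i x \<noteq> take i y @ e # drop i y"
    proof
      assume "take i x @ e # drop i x = take i y @ e # drop i y"
      then have "take i x = take i y \<and> drop i x = drop i y"
        using that by (subst (asm) append_eq_append_conv) auto
      then have "x = y"
        by (metis append_take_drop_id)
      then show False
        using that unfolding cube_less_def by simp
    qed
    ultimately show ?thesis
      unfolding cube_less_def by blast
  qed
  have "ones (take i x @ e # drop i x) = ones x + (if e then 1 else 0)" for x
    \<comment> \<open>The third occurrence of \<open>x\<close> is the one on the right-hand side;
      splitting it at \<open>i\<close> lets both sides filter the same pieces.\<close>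
    unfolding ones_def by (subst (3) append_take_drop_id[of i x, symmetric], unfold filter_append) simp
  then show ?thesis
    using less assms unfolding preserves_length_def by (auto simp: face_def cube_def)
qed

lemma preserves_length_box:
  assumes "f \<in> box_arrows"
  shows "preserves_length f"
  using assms
proof induction
  case (box_ident n)
  then show ?case
    by (simp add: preserves_length_def)
next
  case (box_face f i e)
  then show ?case
    using preserves_length_face[of i "Cod f" e] unfolding preserves_length_def
    by (auto simp: cube_comp_def compose_def face_def)
qed

definition cube_length :: "nat \<Rightarrow> 'u flow_arrow" where
  "cube_length n = Arrow (fob cube_flow n)
     (\<lambda>a\<in>states (fob cube_flow n :: 'u flow). code (),
      \<lambda>p\<in>topspace (paths (fob cube_flow n :: 'u flow)).
        (case decode p of (x, y) \<Rightarrow> code (ones y - ones x)))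
     length_flow"

lemma topspace_paths_cube_flow:
  "topspace (paths (fob cube_flow n)) = code ` {(x, y). x \<in> cube n \<and> y \<in> cube n \<and> cube_less x y}"
  by (simp add: cube_flow_def poset_flow_def)

text \<open>Compatibility with concatenation is a telescoping sum of rank differences.\<close>

lemma cube_length_hom:
  assumes "universe TYPE('u)" "convenient T" "is_flow T (fob cube_flow n :: 'u flow)"
  shows "(cube_length n :: 'u flow_arrow) \<in> hom (Flow T) (fob cube_flow n) length_flow"
proof -
  note [simp] = decode_code[OF assms(1)]
  have code_eq: "(code x :: 'u) = code y \<longleftrightarrow> x = y" for x y :: "bool list"
    using inj_code[OF assms(1)] by (auto dest: injD)
  let ?Q = "fob cube_flow n :: 'u flow"
  let ?l = "\<lambda>p\<in>topspace (paths ?Q). (case decode p of (x, y) \<Rightarrow> code (ones y - ones x)) :: 'u"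
  have pos: "?l p \<in> code ` {0::nat<..}" if p: "p \<in> topspace (paths ?Q)" for p
  proof -
    obtain x y where xy: "p = code (x, y)" "cube_less x y"
      using p by (auto simp: topspace_paths_cube_flow)
    then have "?l p = code (ones y - ones x)"
      using p by simp
    then show ?thesis
      using ones_less[OF xy(2)] by simp
  qed
  have Q: "paths ?Q = discrete_topology (topspace (paths ?Q))"
    by (simp add: cube_flow_def poset_flow_def)
  have cont: "continuous_map (paths ?Q) (paths length_flow) ?l"
    using pos by (subst Q) (simp add: length_flow_def semigroup_flow_def Pi_iff)
  have add: "?l (conc ?Q p q) = conc length_flow (?l p) (?l q)"
    if p: "p \<in> topspace (paths ?Q)" and q: "q \<in> topspace (paths ?Q)" and pq: "tgt ?Q p = src ?Q q" for p q
  proof -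
    obtain x y where xy: "p = code (x, y)" "x \<in> cube n" "y \<in> cube n" "cube_less x y"
      using p by (auto simp: topspace_paths_cube_flow)
    obtain y' z where yz: "q = code (y', z)" "z \<in> cube n" "cube_less y' z"
      using q by (auto simp: topspace_paths_cube_flow)
    have "y' = y"
      using pq by (simp add: xy yz cube_flow_def poset_flow_def code_eq)
    moreover have c: "conc ?Q p q = code (x, z)"
      by (simp add: xy yz cube_flow_def poset_flow_def)
    \<comment> \<open>\<open>?l\<close> is \<open>undefined\<close> off the path space, so its value
      at the composite requires the composite to be a path.\<close>
    moreover have "conc ?Q p q \<in> topspace (paths ?Q)"
      using assms(3) p q pq unfolding is_flow_def by blast
    ultimately show ?thesis
      using p q ones_less[OF xy(4)] ones_less[OF yz(3)]
      by (simp add: xy(1) yz(1) length_flow_def semigroup_flow_def)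
  qed
  then show ?thesis
    using assms(3) is_flow_states[OF assms(3)] is_flow_length_flow[OF assms(1,2)] cont add
    unfolding Flow_arrow_iff is_flow_map_def
    by (simp add: cube_length_def) (simp add: length_flow_def semigroup_flow_def)
qed

text \<open>This turns the lengths of the cubes into a cocone from the cocubical flow to
  \<open>length_flow\<close>.\<close>

lemma cube_length_natural:
  assumes "universe TYPE('u)" "f \<in> box_arrows"
  shows "cube_length (Cod f) \<odot>\<^bsub>Flow T\<^esub> far cube_flow f = (cube_length (Dom f) :: 'u flow_arrow)"
proof -
  note [simp] = decode_code[OF assms(1)]
  note f = preserves_length_box[OF assms(2), unfolded preserves_length_def]
  show ?thesis
    using f
    by (auto simp: Flow_def cube_length_def cube_flow_def Let_def poset_flow_def compose_def fun_eq_iff)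
qed

text \<open>The lengths are pulled back along \<eta> to the flows \<open>fob X n\<close>, where they
  are still compatible with faces; the universal property of the colimit then glues them over all
  cubes of \<open>K\<close>.\<close>

lemma realization_length:
  assumes "universe TYPE('u)" "convenient T" "realization_functor T L" "K \<in> Ob PrSh"
  shows "\<exists>h. h \<in> hom (Flow T) (fob L K) (length_flow :: 'u flow)"
proof -
  obtain X \<eta> \<iota> where X: "is_functor Box (Flow T) X"
    and nt: "nat_trans Box (Flow T) X cube_flow \<eta>"
    and colim: "is_colimit (cube_cat K) (Flow T) (cube_diagram X) (fob L K) (\<iota> K)"
    using assms(3,4) unfolding realization_functor_def extends_cocubical_def by blast
  have \<eta>: "\<eta> n \<in> hom (Flow T) (fob X n) (fob cube_flow n)" for n
    using nt unfolding nat_trans_def by (simp add: Box_def)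
  \<comment> \<open>The poset of a cube is a flow because it is the codomain of a morphism of
    flows.\<close>
  then have "is_flow T (fob cube_flow n :: 'u flow)" for n
    unfolding Flow_arrow_iff by blast
  note \<lambda> = cube_length_hom[OF assms(1,2) this]
  define d where "d = (\<lambda>n. cube_length n \<odot>\<^bsub>Flow T\<^esub> \<eta> n)"
  have d: "d n \<in> hom (Flow T) (fob X n) length_flow" for n
    unfolding d_def by (rule Flow_comp_hom[OF \<eta> \<lambda>])
  have nat: "d (Cod f) \<odot>\<^bsub>Flow T\<^esub> far X f = d (Dom f)" if f: "f \<in> box_arrows" for f
  proof -
    have Xf: "far X f \<in> hom (Flow T) (fob X (Dom f)) (fob X (Cod f))"
      using X f unfolding is_functor_def by (simp add: Box_def)
    have sq: "\<eta> (Cod f) \<odot>\<^bsub>Flow T\<^esub> far X f = far cube_flow f \<odot>\<^bsub>Flow T\<^esub> \<eta> (Dom f)"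
      using nt f unfolding nat_trans_def by (simp add: Box_def)
    have "Dom (\<eta> (Cod f)) = fob X (Cod f)"
      using \<eta> by (simp add: hom_def)
    then have "d (Cod f) \<odot>\<^bsub>Flow T\<^esub> far X f =
        cube_length (Cod f) \<odot>\<^bsub>Flow T\<^esub> (\<eta> (Cod f) \<odot>\<^bsub>Flow T\<^esub> far X f)"
      unfolding d_def by (rule Flow_comp_assoc[OF Xf])
    also have "\<dots> = (cube_length (Cod f) \<odot>\<^bsub>Flow T\<^esub> far cube_flow f) \<odot>\<^bsub>Flow T\<^esub> \<eta> (Dom f)"
      unfolding sq by (rule Flow_comp_assoc[OF \<eta>, symmetric]) (simp add: cube_flow_def)
    also have "\<dots> = d (Dom f)"
      unfolding d_def cube_length_natural[OF assms(1) f] ..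
    finally show ?thesis .
  qed
  \<comment> \<open>The leg at a cube depends only on its dimension, so the cocone condition reduces
    to naturality over \<open>Box\<close>.\<close>
  have "is_cocone (cube_cat K) (Flow T) (cube_diagram X) length_flow (\<lambda>(n, \<sigma>). d n)"
    unfolding is_cocone_def
  proof (intro conjI ballI)
    show "length_flow \<in> Ob (Flow T)"
      using is_flow_length_flow[OF assms(1,2)] by (simp add: Flow_def)
    show "(case j of (n, \<sigma>) \<Rightarrow> d n) \<in> hom (Flow T) (fob (cube_diagram X) j) length_flow" for j
      using d by (auto simp: cube_diagram_def split: prod.split)
    show "(case Cod a of (n, \<sigma>) \<Rightarrow> d n) \<odot>\<^bsub>Flow T\<^esub> far (cube_diagram X) a = (case Dom a of (n, \<sigma>) \<Rightarrow> d n)"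
      if "a \<in> Arr (cube_cat K)" for a
      using that nat by (force simp: cube_cat_def cube_diagram_def Box_def)
  qed
  then show ?thesis
    using colim unfolding is_colimit_def by blast
qed

text \<open>A weak equivalence would leave \<open>X\<close> with one state and a nonempty path
  connected path space. Every path \<open>x\<close> would then be a loop, and the locally constant
  length would agree on \<open>x\<close> and its double, forcing n + n = n with n positive.\<close>

lemma no_weak_equivalence_unit_flow:
  assumes "universe TYPE('u)" "h \<in> hom (Flow T) X (length_flow :: 'u flow)"
    and "f \<in> hom (Flow T) X unit_flow"
  shows "f \<notin> weak_S_homotopy_equivalences T"
proof
  assume w: "f \<in> weak_S_homotopy_equivalences T"
  let ?P = "paths X"
  have D: "Dom f = X" "Cod f = unit_flow"
    using assms(3) by (auto simp: hom_def)
  have E: "states unit_flow = {code ()}" "paths unit_flow = discrete_topology {code ()}"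
    by (simp_all add: unit_flow_def semigroup_flow_def)
  have b: "bij_betw (fst (Fn f)) (states X) {code ()}"
    and "\<exists>F. bij_betw F (path_components_of ?P) (path_components_of (paths (unit_flow :: 'u flow)))"
    using w[unfolded weak_S_homotopy_equivalences_def weak_homotopy_equivalence_def]
    by (auto simp only: D E mem_Collect_eq)
  then obtain F where "bij_betw F (path_components_of ?P) {{code () :: 'u}}"
    unfolding E path_components_of_discrete_topology image_insert image_empty by blast
  then obtain C where "path_components_of ?P = {C}"
    by (metis bij_betw_inv_into bij_betw_imp_surj_on image_empty image_insert)
  \<comment> \<open>Having exactly one path component gives nonemptiness as well as path
    connectedness; the former supplies the loop.\<close>
  then have conn: "path_connected_space ?P" and ne: "topspace ?P \<noteq> {}"
    using path_components_of_eq_singleton[of ?P C] by simp_all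
  obtain x where x: "x \<in> topspace ?P"
    using ne by blast
  have X: "is_flow T X"
    using assms(3) unfolding Flow_arrow_iff by blast
  have "src X x \<in> states X" "tgt X x \<in> states X"
    using is_flow_states[OF X x] .
  then have loop: "tgt X x = src X x"
    using b by (metis bij_betw_def inj_onD bij_betwE singletonD)
  then have xx: "conc X x x \<in> topspace ?P"
    using X x unfolding is_flow_def by blast
  have h: "continuous_map ?P (discrete_topology (code ` {0::nat<..} :: 'u set)) (snd (Fn h))"
    and hxx: "snd (Fn h) (conc X x x) = code (decode (snd (Fn h) x) + decode (snd (Fn h) x) :: nat)"
    using assms(2) x loop unfolding Flow_arrow_iff is_flow_map_def
    by (auto simp: length_flow_def semigroup_flow_def)
  have "connectedin (discrete_topology (code ` {0::nat<..} :: 'u set)) (snd (Fn h) ` topspace ?P)"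
    using h conn by (meson connectedin_continuous_map_image connectedin_topspace path_connected_imp_connected_space)
  then have "snd (Fn h) (conc X x x) = snd (Fn h) x"
    using x xx unfolding connectedin_discrete_topology by auto
  moreover obtain n :: nat where n: "snd (Fn h) x = code n" "n > 0"
    using continuous_map_funspace[OF h] x by auto
  ultimately have "(code (n + n) :: 'u) = code n"
    using hxx by (simp add: decode_code[OF assms(1)])
  then show False
    using n(2) injD[OF inj_code[OF assms(1)], of "n + n" n] by simp
qed


section \<open>The empty precubical set\<close>

text \<open>The levelwise empty presheaf is initial. Cofibrancy refers to an initial object, and the
  cofibrant replacement of the nerve is built by factoring the map out of it.\<close>

lemma initial_PrSh:
  assumes "universe TYPE('u)"
  shows "\<exists>I. initial PrSh (I :: 'u prsh)"
proof -
  define I :: "'u prsh" where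
    \<comment> \<open>The only extensional function on the empty set is constantly
      \<open>undefined\<close>.\<close>
    "I = \<lparr>fob = (\<lambda>_. {}), far = (\<lambda>_. Arrow {} (\<lambda>_. undefined) {})\<rparr>"
  have small: "small TYPE('u) {}"
    by (simp add: universe_small_countable[OF assms])
  have I: "is_functor (op_cat Box) Set_cat I"
    using small unfolding is_functor_def
    by (auto simp: I_def Set_cat_def hom_def compose_def restrict_def)
  have "\<exists>!f. f \<in> hom PrSh I K" if K: "is_functor (op_cat Box) Set_cat K" for K
  proof
    let ?f = "Arrow I (\<lambda>n. Arrow {} (\<lambda>_. undefined) (fob K n)) K"
    show "?f \<in> hom PrSh I K"
    proof -
      have "nat_trans (op_cat Box) Set_cat I K (Fn ?f)"
        using K small unfolding nat_trans_def is_functor_def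
        by (auto simp: I_def Set_cat_def hom_def compose_def restrict_def)
      then show ?thesis
        using K I by (simp add: PrSh_def functor_cat_def hom_def op_cat_def Box_def extensional_def)
    qed
    fix f
    assume "f \<in> hom PrSh I K"
    then have f: "Dom f = I" "Cod f = K"
      and *: "Fn f n \<in> hom Set_cat (fob I n) (fob K n)" for n
      by (auto simp: PrSh_def functor_cat_def hom_def nat_trans_def op_cat_def Box_def)
    have "Fn f n = Arrow {} (\<lambda>_. undefined) (fob K n)" for n
      using *[of n] by (cases "Fn f n") (auto simp: I_def Set_cat_def hom_def)
    then show "f = ?f"
      using f by (cases f) auto
  qed
  then show ?thesis
    using I unfolding initial_def by (intro exI[of _ I]) (simp add: PrSh_def functor_cat_def)
qed

section \<open>The derived counit at the terminal flow\<close>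

theorem theorem1p1:
  fixes T :: "'u topology set"
    and L :: "'u real_functor"
    and M :: "('u prsh, nat \<Rightarrow> ('u set, 'u \<Rightarrow> 'u) arrow) model"
  assumes "universe TYPE('u)"
    and "convenient T"
    and "model_structure PrSh M"
    and "realization_functor T L"
    and "quillen_pair PrSh M (Flow T) (Flow_model T) L (nerve T L) (nerve_adjunct T L)"
  shows "\<not> quillen_equivalence PrSh M (Flow T) (Flow_model T) L (nerve T L) (nerve_adjunct T L)"
proof
  assume eq: "quillen_equivalence PrSh M (Flow T) (Flow_model T) L (nerve T L) (nerve_adjunct T L)"
  let ?N = "fob (nerve T L) unit_flow"
  have E: "unit_flow \<in> Ob (Flow T)"
    using terminal_unit_flow[OF assms(1,2)] unfolding terminal_def by blast
  have adj: "adjunction PrSh (Flow T) L (nerve T L) (nerve_adjunct T L)"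
    using assms(5) unfolding quillen_pair_def by blast
  then have N: "?N \<in> Ob PrSh"
    using E unfolding adjunction_def is_functor_def by blast
  obtain I where I: "initial PrSh (I :: 'u prsh)"
    using initial_PrSh[OF assms(1)] by blast
  then obtain g where "g \<in> hom PrSh I ?N"
    using N unfolding initial_def by blast
  then have g: "g \<in> Arr PrSh" "Dom g = I" "Cod g = ?N"
    unfolding hom_def by auto
  \<comment> \<open>Factoring the map from the initial presheaf as a cofibration followed by a
    trivial fibration makes \<open>Dom p\<close> a cofibrant replacement of the nerve of the
    terminal flow.\<close>
  have subs: "Cof M \<subseteq> Arr PrSh" "Fib M \<subseteq> Arr PrSh"
    and "\<exists>i\<in>Cof M. \<exists>p\<in>Fib M \<inter> Weq M.
      Cod i = Dom p \<and> p \<odot>\<^bsub>PrSh\<^esub> i = g \<and> Dom i = Dom g \<and> Cod p = Cod g"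
    using assms(3) g(1) unfolding model_structure_def by blast+
  then obtain i p where i: "i \<in> Cof M" "Dom i = I" and p: "p \<in> Fib M" "p \<in> Weq M" "Cod p = ?N"
    and ip: "Cod i = Dom p"
    using g by auto
  have A: "Dom p \<in> Ob PrSh"
    using p(1) subs(2) by (auto simp: PrSh_def functor_cat_def)
  have "cofibrant PrSh M (Dom p)"
    using A I i ip subs(1) unfolding cofibrant_def hom_def by blast
  note weq = eq[unfolded quillen_equivalence_def, THEN conjunct2, rule_format,
    OF conjI[OF this fibrant_unit_flow[OF assms(1,2)]]]
  have "p \<in> hom PrSh (Dom p) ?N"
    using p subs(2) unfolding hom_def by auto
  moreover have "bij_betw (nerve_adjunct T L (Dom p) unit_flow)
      (hom (Flow T) (fob L (Dom p)) unit_flow) (hom PrSh (Dom p) ?N)"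
    using adj A E unfolding adjunction_def by blast
  \<comment> \<open>The weak equivalence \<open>p\<close> is the adjunct of some \<open>f\<close>
    from the realization of \<open>Dom p\<close> to the terminal flow. A Quillen equivalence would
    make \<open>f\<close> a weak equivalence too, which the length forbids.\<close>
  ultimately have "p \<in> nerve_adjunct T L (Dom p) unit_flow ` hom (Flow T) (fob L (Dom p)) unit_flow"
    by (simp only: bij_betw_imp_surj_on)
  then obtain f where f: "f \<in> hom (Flow T) (fob L (Dom p)) unit_flow"
    and "nerve_adjunct T L (Dom p) unit_flow f = p"
    by (elim imageE) simp
  then have "f \<in> weak_S_homotopy_equivalences T"
    using weq[OF f] p(2) by (simp add: Flow_model_def Let_def)
  then show False
    using realization_length[OF assms(1,2,4) A] no_weak_equivalence_unit_flow[OF assms(1) _ f] by blast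
qed

end
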